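(* Let $a,b$ be nonzero complex numbers with $|ab|<1$, and let $$S_0=\sum_{n\in\mathbb{Z},\ n\equiv 0\ (\mathrm{mod}\ 2)} a^{n(n+1)/2} b^{n(n-1)/2},\qquad S_1=\sum_{n\in\mathbb{Z},\ n\equiv 1\ (\mathrm{mod}\ 2)} a^{n(n+1)/2} b^{n(n-1)/2}$$ be the even and odd components of the dissection of $f(a,b)$. Then $$S_0 = f(a^3b,\, ab^3) = \tfrac{1}{2}\left[ f(a, b) + f(-a, -b) \right],$$ $$S_1 = a\, f(a^5b^3,\, a^{-1}b) = \tfrac{1}{2}\left[ f(a, b) - f(-a, -b) \right].$$
   Context: Ramanujan's theta function is defined, for complex numbers $x,y$ with $|xy|<1$, by $$f(x,y) = \sum_{n=-\infty}^{\infty} x^{n(n+1)/2}\, y^{n(n-1)/2}.$$ *)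

theory Defs
  imports "HOL-Analysis.Analysis" "HOL-Number_Theory.Cong"
begin

text \<open>
  Both exponents are non-negative integers for every integer \<open>n\<close>, and the division by 2 is exact.
  The definition is meaningful for \<open>norm (x * y) < 1\<close>, where the two-sided series converges
  absolutely. The case \<open>x = 0\<close> or \<open>y = 0\<close> is included, with the convention that the zeroth power
  of 0 is 1.
\<close>

definition ramanujan_f :: "complex \<Rightarrow> complex \<Rightarrow> complex" where
  "ramanujan_f x y = (\<Sum>\<^sub>\<infinity>n::int. x powi (n * (n + 1) div 2) * y powi (n * (n - 1) div 2))"

end

theory Submission
  imports Defs
begin

text \<open>
  Substituting \<open>n = 2m\<close> and \<open>n = 2m + 1\<close> turns the even and odd parts of the series for \<open>f(a, b)\<close>
  into the series for \<open>f(a^3 b, a b^3)\<close> and \<open>a f(a^5 b^3, b / a)\<close>. The exponents of the \<open>n\<close>-th term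
  add up to \<open>n^2\<close>, which has the parity of \<open>n\<close>, so negating both arguments negates
  exactly the odd terms; absolute convergence then gives the half-sum and half-difference.
\<close>

definition theta_term :: "complex \<Rightarrow> complex \<Rightarrow> int \<Rightarrow> complex" where
  "theta_term x y n = x powi (n * (n + 1) div 2) * y powi (n * (n - 1) div 2)"

text \<open>Removes integer division: both exponents become linear in \<open>k\<close> and
  \<open>n\<close>, and the relation \<open>2 * k = n * (n - 1)\<close> suffices to recompute
  exponents at shifted or doubled indices.\<close>

lemma triangular_int:
  fixes n :: int
  obtains k where "n * (n - 1) div 2 = k" "n * (n + 1) div 2 = k + n" "2 * k = n * (n - 1)"
proof -
  have "even (n * (n - 1))" by simp
  then obtain k where k: "n * (n - 1) = 2 * k" by (elim evenE)
  have "n * (n + 1) = 2 * (k + n)" using k by (simp add: algebra_simps)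
  with k show thesis by (intro that[of k]) simp_all
qed

text \<open>Reflection exchanges the two exponents, so the negative half of the series is the
  non-negative half with the arguments swapped.\<close>

lemma theta_term_uminus: "theta_term x y (- n) = theta_term y x n"
proof -
  have "- n * (- n + 1) = n * (n - 1)" "- n * (- n - 1) = n * (n + 1)"
    by (simp_all add: algebra_simps)
  then have "theta_term x y (- n)
      = x powi (n * (n - 1) div 2) * y powi (n * (n + 1) div 2)"
    unfolding theta_term_def by (simp only:)
  then show ?thesis unfolding theta_term_def by (simp only: mult.commute)
qed

text \<open>From \<open>n\<close> to \<open>n + 1\<close> the exponent of \<open>x\<close> grows by
  \<open>n + 1\<close> and that of \<open>y\<close> by \<open>n\<close>. This is the term ratio for
  the ratio test.\<close>

lemma theta_term_Suc:
  assumes "x \<noteq> 0" "y \<noteq> 0"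
  shows "theta_term x y (int (Suc n)) = x * (x * y) ^ n * theta_term x y (int n)"
proof -
  obtain k where k: "int n * (int n - 1) div 2 = k" "int n * (int n + 1) div 2 = k + int n"
      "2 * k = int n * (int n - 1)"
    by (rule triangular_int)
  have "int (Suc n) * (int (Suc n) + 1) = 2 * (k + 2 * int n + 1)"
    using k(3) by (simp add: algebra_simps)
  then have e1: "int (Suc n) * (int (Suc n) + 1) div 2 = k + 2 * int n + 1" by simp
  have "int (Suc n) * (int (Suc n) - 1) = 2 * (k + int n)"
    using k(3) by (simp add: algebra_simps)
  then have e2: "int (Suc n) * (int (Suc n) - 1) div 2 = k + int n" by simp
  have "k + 2 * int n + 1 = int (Suc n) + (k + int n)" by simp
  then have "x powi (k + 2 * int n + 1) = x * x ^ n * x powi (k + int n)"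
    using assms by (simp only: power_int_add power_int_of_nat power_Suc simp_thms)
  moreover have "y powi (k + int n) = y ^ n * y powi k"
    by (subst power_int_add) (use assms in \<open>simp_all add: mult.commute\<close>)
  ultimately show ?thesis
    unfolding theta_term_def e1 e2 k(1,2)
    by (simp only: power_mult_distrib mult.commute mult.left_commute mult.assoc)
qed

text \<open>The ratio of consecutive norms is a constant times a power of
  \<open>norm (x * y) < 1\<close>. It tends to 0 however large \<open>norm x\<close> is, so it
  eventually drops below 1/2.\<close>

lemma summable_norm_theta_term_nat:
  assumes "x \<noteq> 0" "y \<noteq> 0" "norm (x * y) < 1"
  shows "summable (\<lambda>n. norm (theta_term x y (int n)))"
proof -
  have "(\<lambda>n. norm x * norm (x * y) ^ n) \<longlonglongrightarrow> norm x * 0"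
    using assms(3) by (intro tendsto_mult tendsto_const LIMSEQ_power_zero) simp
  then have "eventually (\<lambda>n. norm x * norm (x * y) ^ n < 1 / 2) sequentially"
    by (rule order_tendstoD) simp
  then obtain N where N: "norm x * norm (x * y) ^ n < 1 / 2" if "n \<ge> N" for n
    by (auto simp: eventually_sequentially)
  show ?thesis
  proof (rule summable_ratio_test[of "1 / 2" N])
    fix n assume "N \<le> n"
    have "norm (theta_term x y (int (Suc n)))
        = norm x * norm (x * y) ^ n * norm (theta_term x y (int n))"
      by (simp only: theta_term_Suc[OF assms(1,2)] norm_mult norm_power)
    also have "\<dots> \<le> 1 / 2 * norm (theta_term x y (int n))"
      using N[OF \<open>N \<le> n\<close>] by (intro mult_right_mono) auto
    finally show "norm (norm (theta_term x y (int (Suc n))))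
        \<le> 1 / 2 * norm (norm (theta_term x y (int n)))" by simp
  qed simp
qed

lemma theta_term_summable_on:
  assumes "x \<noteq> 0" "y \<noteq> 0" "norm (x * y) < 1"
  shows "theta_term x y summable_on A"
proof -
  have nonneg: "theta_term u v summable_on range int"
    if "u \<noteq> 0" "v \<noteq> 0" "norm (u * v) < 1" for u v
  proof -
    have "(\<lambda>n. theta_term u v (int n)) summable_on UNIV"
      by (intro norm_summable_imp_summable_on summable_norm_theta_term_nat that)
    then show ?thesis by (simp add: summable_on_reindex o_def)
  qed
  have "theta_term y x summable_on range int"
    using assms by (intro nonneg) (simp_all add: mult.commute)
  then have "theta_term x y summable_on uminus ` range int"
    by (simp add: summable_on_reindex o_def theta_term_uminus)
  \<comment> \<open>The two halves overlap at 0, which is harmless: a union of summable index sets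
    need not be disjoint.\<close>
  then have "theta_term x y summable_on (range int \<union> uminus ` range int)"
    using nonneg[OF assms] by (intro summable_on_union)
  moreover have "n \<in> range int \<union> uminus ` range int" for n
    by (cases n rule: int_cases2) auto
  ultimately show ?thesis
    by (rule_tac summable_on_subset_banach[of _ "range int \<union> uminus ` range int"]) blast+
qed

lemma theta_term_minus_minus:
  "theta_term (- x) (- y) n = (if even n then theta_term x y n else - theta_term x y n)"
proof -
  obtain k where k: "n * (n - 1) div 2 = k" "n * (n + 1) div 2 = k + n"
    by (rule triangular_int)
  show ?thesis
    unfolding theta_term_def k by (auto simp: power_int_minus_left)
qed

lemma theta_term_even:
  assumes "a \<noteq> 0" "b \<noteq> 0"
  shows "theta_term a b (2 * m) = theta_term (a ^ 3 * b) (a * b ^ 3) m"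
proof -
  obtain k where k: "m * (m - 1) div 2 = k" "m * (m + 1) div 2 = k + m" "2 * k = m * (m - 1)"
    by (rule triangular_int)
  \<comment> \<open>The exponents are split along \<open>k + m\<close> and \<open>k\<close>, the
    exponents of the target term: the coefficients 3, 1 of \<open>k + m\<close> give the base
    \<open>a ^ 3 * b\<close>, and the coefficients 1, 3 of \<open>k\<close> give
    \<open>a * b ^ 3\<close>.\<close>
  have e: "2 * m * (2 * m + 1) div 2 = 3 * (k + m) + k" "2 * m * (2 * m - 1) div 2 = k + m + 3 * k"
    using k(3) by (simp_all add: algebra_simps)
  show ?thesis
    unfolding theta_term_def k(1,2) e using assms
    by (simp add: power_int_add power_int_mult_distrib power_int_mult eval_nat_numeral)
qed

lemma theta_term_odd:
  assumes "a \<noteq> 0" "b \<noteq> 0"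
  shows "theta_term a b (2 * m + 1) = a * theta_term (a ^ 5 * b ^ 3) (inverse a * b) m"
proof -
  obtain k where k: "m * (m - 1) div 2 = k" "m * (m + 1) div 2 = k + m" "2 * k = m * (m - 1)"
    by (rule triangular_int)
  \<comment> \<open>The same splitting: the summand 1 becomes the factor \<open>a\<close> in front,
    the coefficients 5, 3 of \<open>k + m\<close> give \<open>a ^ 5 * b ^ 3\<close>, and the
    coefficients -1, 1 of \<open>k\<close> give \<open>inverse a * b\<close>.\<close>
  have "(2 * m + 1) * (2 * m + 1 + 1) = 2 * (1 + 5 * (k + m) - k)"
    "(2 * m + 1) * (2 * m + 1 - 1) = 2 * (3 * (k + m) + k)"
    using k(3) by (simp_all add: algebra_simps)
  then have e: "(2 * m + 1) * (2 * m + 1 + 1) div 2 = 1 + 5 * (k + m) - k"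
    "(2 * m + 1) * (2 * m + 1 - 1) div 2 = 3 * (k + m) + k"
    by simp_all
  have "a powi (1 + 5 * (k + m) - k) = a * (a ^ 5) powi (k + m) * inverse a powi k"
    using assms by (simp add: power_int_add power_int_diff power_int_mult power_int_mult_distrib
        divide_simps eval_nat_numeral)
  moreover have "b powi (3 * (k + m) + k) = (b ^ 3) powi (k + m) * b powi k"
    using assms by (simp add: power_int_add power_int_mult power_int_mult_distrib eval_nat_numeral)
  ultimately show ?thesis
    unfolding theta_term_def k(1,2) e by (simp add: power_int_mult_distrib)
qed

theorem corollary2p2:
  fixes a b S\<^sub>0 S\<^sub>1 :: complex
  assumes "a \<noteq> 0" and "b \<noteq> 0" and "norm (a * b) < 1"
    and "S\<^sub>0 = (\<Sum>\<^sub>\<infinity>n\<in>{n::int. [n = 0] (mod 2)}. a powi (n * (n + 1) div 2) * b powi (n * (n - 1) div 2))"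
    and "S\<^sub>1 = (\<Sum>\<^sub>\<infinity>n\<in>{n::int. [n = 1] (mod 2)}. a powi (n * (n + 1) div 2) * b powi (n * (n - 1) div 2))"
  shows "S\<^sub>0 = ramanujan_f (a ^ 3 * b) (a * b ^ 3)
    \<and> ramanujan_f (a ^ 3 * b) (a * b ^ 3) = 1 / 2 * (ramanujan_f a b + ramanujan_f (- a) (- b))
    \<and> S\<^sub>1 = a * ramanujan_f (a ^ 5 * b ^ 3) (inverse a * b)
    \<and> a * ramanujan_f (a ^ 5 * b ^ 3) (inverse a * b) = 1 / 2 * (ramanujan_f a b - ramanujan_f (- a) (- b))"
proof -
  define E D where "E = {n::int. [n = 0] (mod 2)}" and "D = {n::int. [n = 1] (mod 2)}"
  have E: "n \<in> E \<longleftrightarrow> even n" and D: "n \<in> D \<longleftrightarrow> odd n" for n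
    by (auto simp: E_def D_def cong_def even_iff_mod_2_eq_zero odd_iff_mod_2_eq_one)
  have f: "ramanujan_f x y = infsum (theta_term x y) UNIV" for x y
    unfolding ramanujan_f_def theta_term_def ..
  have S: "S\<^sub>0 = infsum (theta_term a b) E" "S\<^sub>1 = infsum (theta_term a b) D"
    unfolding assms(4,5) E_def D_def theta_term_def by (rule refl)+
  have UN: "UNIV = E \<union> D" and disj: "E \<inter> D = {}" using E D by auto
  have "E = range (\<lambda>m. 2 * m)" "D = range (\<lambda>m. 2 * m + 1)"
    using E D by (auto elim!: evenE oddE)
  then have 1: "S\<^sub>0 = ramanujan_f (a ^ 3 * b) (a * b ^ 3)"
    and 2: "S\<^sub>1 = a * ramanujan_f (a ^ 5 * b ^ 3) (inverse a * b)"
    unfolding S f using assms(1,2)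
    by (simp_all add: infsum_reindex inj_on_def o_def theta_term_even theta_term_odd
        infsum_cmult_right')
  \<comment> \<open>Convergence enters here, since additivity of \<open>infsum\<close> requires
    summability on both classes. General \<open>x\<close> and \<open>y\<close> allow use at
    \<open>(a, b)\<close> and at \<open>(- a, - b)\<close>, whose products coincide.\<close>
  have split: "infsum (theta_term x y) UNIV = infsum (theta_term x y) E + infsum (theta_term x y) D"
    if "x \<noteq> 0" "y \<noteq> 0" "norm (x * y) < 1" for x y
    unfolding UN by (intro infsum_Un_disjoint theta_term_summable_on that disj)
  have "infsum (theta_term (- a) (- b)) E = S\<^sub>0"
    unfolding S by (intro infsum_cong) (simp add: theta_term_minus_minus E)
  moreover have "infsum (theta_term (- a) (- b)) D = infsum (\<lambda>n. - theta_term a b n) D"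
    by (intro infsum_cong) (simp add: theta_term_minus_minus D)
  then have "infsum (theta_term (- a) (- b)) D = - S\<^sub>1"
    unfolding S by (simp add: infsum_uminus)
  ultimately have "ramanujan_f (- a) (- b) = S\<^sub>0 - S\<^sub>1"
    unfolding f using split[of "- a" "- b"] assms(1-3) by simp
  moreover have "ramanujan_f a b = S\<^sub>0 + S\<^sub>1"
    unfolding f using split[OF assms(1-3)] S by simp
  ultimately show ?thesis using 1 2 by simp
qed

end
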